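(* Let $0<q\le 1$ and suppose that $\mathcal{A}$ is a proper $q$-Banach subalgebra of $\mathcal{B}(\ell^2(\mathbb{G}))$. Then $$\sigma_{\mathcal{A}}(A)=\sigma_{\mathcal{B}(\ell^2(\mathbb{G}))}(A)\quad\text{for all }A\in\mathcal{A},$$ where the spectral set $\sigma_{\mathcal{A}}(A)$ is defined by $\mathbb{C}\setminus\sigma_{\mathcal{A}}(A):=\{\lambda\in\mathbb{C}\mid \lambda I-A\text{ has bounded inverse in }\mathcal{A}\}$, and $\sigma_{\mathcal{B}(\ell^2(\mathbb{G}))}(A)$ is defined in the same way with $\mathcal{B}(\ell^2(\mathbb{G}))$ in place of $\mathcal{A}$.
   Context: $\mathbb{G}\subset\mathbb{Z}^d$ ($d\ge 1$) is the discrete spatial domain, and $\mathcal{B}(\ell^2(\mathbb{G}))$ is the Banach algebra of bounded linear operators on $\ell^2(\mathbb{G})$, identified with (infinite) matrices indexed by $\mathbb{G}\times\mathbb{G}$. For $0<q\le 1$, a complex vector space $\mathcal{A}$ of matrices is a $q$-Banach space with $q$-norm $\|\cdot\|_{\mathcal{A}}$ if it is complete with respect to the metric $d(A,B)=\|A-B\|_{\mathcal{A}}^q$ and, for all $A,B\in\mathcal{A}$, $\alpha\in\mathbb{C}$: (i) $\|A\|_{\mathcal{A}}\ge 0$, with equality iff $A=0$; (ii) $\|\alpha A\|_{\mathcal{A}}=|\alpha|\,\|A\|_{\mathcal{A}}$; (iii) $\|A+B\|_{\mathcal{A}}^q\le\|A\|_{\mathcal{A}}^q+\|B\|_{\mathcal{A}}^q$.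 A $q$-Banach space $\mathcal{A}$ is a $q$-Banach algebra if it contains the unit element $I$, with $M:=\|I\|_{\mathcal{A}}<\infty$, and there is a constant $K_0>0$ with (iv) $AB\in\mathcal{A}$ and $\|AB\|_{\mathcal{A}}\le K_0\|A\|_{\mathcal{A}}\|B\|_{\mathcal{A}}$ for all $A,B\in\mathcal{A}$. A $q$-Banach algebra $\mathcal{A}$ of matrices on $\mathbb{G}$ is proper (a proper $q$-Banach subalgebra of $\mathcal{B}(\ell^2(\mathbb{G}))$) if: (P1) $A^*\in\mathcal{A}$ and $\|A^*\|_{\mathcal{A}}=\|A\|_{\mathcal{A}}$ for all $A\in\mathcal{A}$; (P2) $\mathcal{A}$ is a subalgebra of $\mathcal{B}(\ell^2(\mathbb{G}))$ and $\|A\|_{\mathcal{B}(\ell^2(\mathbb{G}))}\le\|A\|_{\mathcal{A}}$ for all $A\in\mathcal{A}$; (P3) $\mathcal{A}$ is a differential subalgebra of $\mathcal{B}=\mathcal{B}(\ell^2(\mathbb{G}))$ of some order $\theta\in(0,1]$: there is a constant $D>0$ such that for all $A,B\in\mathcal{A}$, $$\|AB\|_{\mathcal{A}}^q\le D\,\|A\|_{\mathcal{A}}^q\|B\|_{\mathcal{A}}^q\left(\Big(\tfrac{\|A\|_{\mathcal{B}}}{\|A\|_{\mathcal{A}}}\Big)^{q\theta}+\Big(\tfrac{\|B\|_{\mathcal{B}}}{\|B\|_{\mathcal{A}}}\Big)^{q\theta}\right)$$ (right side read as $0$ if $A=0$ or $B=0$). *)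

theory Defs
  imports "HOL-Analysis.Analysis" "HOL-Library.Function_Algebras"
begin

text \<open>
  The index set \<open>G\<close> is a subset of a type, so sequences on \<open>G\<close> and \<open>G \<times> G\<close> matrices are
  represented by total functions that vanish outside of \<open>G\<close>; this makes the representation unique.
  Sums, differences, negatives and \<open>0\<close> of sequences and matrices are the pointwise ones of
  \<^theory>\<open>HOL-Library.Function_Algebras\<close>.  The pointwise \<open>*\<close> and \<open>1\<close> on functions
  from that theory are never used.
\<close>

definition ell2 :: "'i set \<Rightarrow> ('i \<Rightarrow> complex) set" where
  "ell2 G = {f. (\<forall>i. i \<notin> G \<longrightarrow> f i = 0) \<and> (\<lambda>i. (cmod (f i))\<^sup>2) summable_on G}"

definition ell2_norm :: "'i set \<Rightarrow> ('i \<Rightarrow> complex) \<Rightarrow> real" where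
  "ell2_norm G f = sqrt (\<Sum>\<^sub>\<infinity>i\<in>G. (cmod (f i))\<^sup>2)"

definition bounded_op :: "'i set \<Rightarrow> (('i \<Rightarrow> complex) \<Rightarrow> ('i \<Rightarrow> complex)) \<Rightarrow> bool" where
  "bounded_op G T \<longleftrightarrow>
     (\<forall>f\<in>ell2 G. T f \<in> ell2 G) \<and>
     (\<forall>f\<in>ell2 G. \<forall>g\<in>ell2 G. T (f + g) = T f + T g) \<and>
     (\<forall>f\<in>ell2 G. \<forall>\<alpha>. T (\<lambda>i. \<alpha> * f i) = (\<lambda>i. \<alpha> * T f i)) \<and>
     (\<exists>K. \<forall>f\<in>ell2 G. ell2_norm G (T f) \<le> K * ell2_norm G f)"

type_synonym 'i cmatrix = "'i \<Rightarrow> 'i \<Rightarrow> complex"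

definition matrices :: "'i set \<Rightarrow> 'i cmatrix set" where
  "matrices G = {A. \<forall>i j. (i, j) \<notin> G \<times> G \<longrightarrow> A i j = 0}"

definition mat_apply :: "'i set \<Rightarrow> 'i cmatrix \<Rightarrow> ('i \<Rightarrow> complex) \<Rightarrow> ('i \<Rightarrow> complex)" where
  "mat_apply G A f = (\<lambda>i. if i \<in> G then \<Sum>\<^sub>\<infinity>j\<in>G. A i j * f j else 0)"

definition mat_scale :: "complex \<Rightarrow> 'i cmatrix \<Rightarrow> 'i cmatrix" where
  "mat_scale \<alpha> A = (\<lambda>i j. \<alpha> * A i j)"

definition mat_id :: "'i set \<Rightarrow> 'i cmatrix" where
  "mat_id G = (\<lambda>i j. if i \<in> G \<and> i = j then 1 else 0)"

text \<open>
  The series in the matrix product converge absolutely for matrices of bounded operators, and the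
  product is then the matrix of the composition (lemma \<open>mat_apply_mult\<close> below).
\<close>

definition mat_mult :: "'i set \<Rightarrow> 'i cmatrix \<Rightarrow> 'i cmatrix \<Rightarrow> 'i cmatrix" where
  "mat_mult G A B = (\<lambda>i j. if i \<in> G \<and> j \<in> G then \<Sum>\<^sub>\<infinity>k\<in>G. A i k * B k j else 0)"

definition mat_adj :: "'i cmatrix \<Rightarrow> 'i cmatrix" where
  "mat_adj A = (\<lambda>i j. cnj (A j i))"

text \<open>
  \<open>bl_matrices G\<close> is the algebra of bounded linear operators on \<open>ell2 G\<close>, each operator being
  identified with its matrix.  Lemma \<open>bounded_op_ex1_matrix\<close> below shows that every bounded
  operator is represented by exactly one element of this set.
\<close>

definition bl_matrices :: "'i set \<Rightarrow> 'i cmatrix set" where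
  "bl_matrices G = {A \<in> matrices G.
     (\<forall>f\<in>ell2 G. \<forall>i\<in>G. (\<lambda>j. A i j * f j) summable_on G) \<and> bounded_op G (mat_apply G A)}"

definition op_norm :: "'i set \<Rightarrow> 'i cmatrix \<Rightarrow> real" where
  "op_norm G A = (SUP f\<in>{f \<in> ell2 G. ell2_norm G f \<le> 1}. ell2_norm G (mat_apply G A f))"

text \<open>
  The locale \<^locale>\<open>Metric_space\<close> requires symmetry and nonnegativity on the whole type, hence the
  truncation of the metric outside of the carrier.
\<close>

definition qdist :: "'i cmatrix set \<Rightarrow> ('i cmatrix \<Rightarrow> real) \<Rightarrow> real \<Rightarrow> 'i cmatrix \<Rightarrow> 'i cmatrix \<Rightarrow> real"
  where "qdist \<A> N q A B = (if A \<in> \<A> \<and> B \<in> \<A> then N (A - B) powr q else 0)"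

locale q_banach_space =
  fixes G :: "'i set" and q :: real and \<A> :: "'i cmatrix set" and N :: "'i cmatrix \<Rightarrow> real"
  assumes q_pos: "0 < q" and q_le_1: "q \<le> 1"
    and carrier_subset: "\<A> \<subseteq> matrices G"
    and zero_closed: "0 \<in> \<A>"
    and add_closed: "\<And>A B. A \<in> \<A> \<Longrightarrow> B \<in> \<A> \<Longrightarrow> A + B \<in> \<A>"
    and scale_closed: "\<And>\<alpha> A. A \<in> \<A> \<Longrightarrow> mat_scale \<alpha> A \<in> \<A>"
    and norm_nonneg: "\<And>A. A \<in> \<A> \<Longrightarrow> 0 \<le> N A"
    and norm_eq_0_iff: "\<And>A. A \<in> \<A> \<Longrightarrow> N A = 0 \<longleftrightarrow> A = 0"
    and norm_scale: "\<And>\<alpha> A. A \<in> \<A> \<Longrightarrow> N (mat_scale \<alpha> A) = cmod \<alpha> * N A"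
    and norm_triangle: "\<And>A B. A \<in> \<A> \<Longrightarrow> B \<in> \<A> \<Longrightarrow> N (A + B) powr q \<le> N A powr q + N B powr q"
    and complete: "Metric_space.mcomplete \<A> (qdist \<A> N q)"

locale q_banach_algebra = q_banach_space +
  assumes id_closed: "mat_id G \<in> \<A>"
    and mult_closed: "\<And>A B. A \<in> \<A> \<Longrightarrow> B \<in> \<A> \<Longrightarrow> mat_mult G A B \<in> \<A>"
    and norm_mult: "\<exists>K\<^sub>0>0. \<forall>A\<in>\<A>. \<forall>B\<in>\<A>. N (mat_mult G A B) \<le> K\<^sub>0 * N A * N B"

text \<open>
  In the last condition the right-hand side is \<open>0\<close> when \<open>A = 0\<close> or \<open>B = 0\<close>, because
  \<open>0 powr q = 0\<close> and \<open>x / 0 = 0\<close>.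
\<close>

locale proper_q_banach_algebra = q_banach_algebra +
  assumes adj_closed: "\<And>A. A \<in> \<A> \<Longrightarrow> mat_adj A \<in> \<A>"
    and norm_adj: "\<And>A. A \<in> \<A> \<Longrightarrow> N (mat_adj A) = N A"
    and subset_bl: "\<A> \<subseteq> bl_matrices G"
    and op_norm_le: "\<And>A. A \<in> \<A> \<Longrightarrow> op_norm G A \<le> N A"
    and differential: "\<exists>\<theta> D. 0 < \<theta> \<and> \<theta> \<le> 1 \<and> 0 < D \<and> (\<forall>A\<in>\<A>. \<forall>B\<in>\<A>.
      N (mat_mult G A B) powr q \<le> D * N A powr q * N B powr q *
        ((op_norm G A / N A) powr (q * \<theta>) + (op_norm G B / N B) powr (q * \<theta>)))"

definition resolvent_set :: "'i set \<Rightarrow> 'i cmatrix set \<Rightarrow> 'i cmatrix \<Rightarrow> complex set" where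
  "resolvent_set G \<A> A = {z. \<exists>B\<in>\<A>.
     mat_mult G (mat_scale z (mat_id G) - A) B = mat_id G \<and>
     mat_mult G B (mat_scale z (mat_id G) - A) = mat_id G}"

definition spectral_set :: "'i set \<Rightarrow> 'i cmatrix set \<Rightarrow> 'i cmatrix \<Rightarrow> complex set" where
  "spectral_set G \<A> A = - resolvent_set G \<A> A"


section \<open>Consistency of the definitions\<close>

lemma (in q_banach_space) Metric_space_qdist: "Metric_space \<A> (qdist \<A> N q)"
proof -
  have neg: "- A = mat_scale (-1) A" for A :: "'a cmatrix"
    by (auto simp: mat_scale_def fun_eq_iff)
  have diff: "A - B \<in> \<A>" if "A \<in> \<A>" "B \<in> \<A>" for A B
  proof -
    have "A - B = A + mat_scale (-1) B" by (auto simp: mat_scale_def fun_eq_iff)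
    then show ?thesis by (simp only: add_closed[OF that(1) scale_closed[OF that(2)]])
  qed
  have sym: "N (A - B) = N (B - A)" if "A \<in> \<A>" "B \<in> \<A>" for A B
    using norm_scale[OF diff[OF that], of "-1"] neg[of "A - B"] by simp
  show ?thesis
  proof
    show "0 \<le> qdist \<A> N q x y" for x y by (simp add: qdist_def)
    show "qdist \<A> N q x y = qdist \<A> N q y x" for x y by (auto simp: qdist_def sym)
    show "qdist \<A> N q x y = 0 \<longleftrightarrow> x = y" if "x \<in> \<A>" "y \<in> \<A>" for x y
      using that diff[OF that] norm_eq_0_iff[OF diff[OF that]] by (simp add: qdist_def)
    show "qdist \<A> N q x z \<le> qdist \<A> N q x y + qdist \<A> N q y z"
      if "x \<in> \<A>" "y \<in> \<A>" "z \<in> \<A>" for x y z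
      using norm_triangle[OF diff[OF that(1,2)] diff[OF that(2,3)]] that by (simp add: qdist_def)
  qed
qed

lemma ell2_coord_le: "f \<in> ell2 G \<Longrightarrow> cmod (f i) \<le> ell2_norm G f"
proof (cases "i \<in> G")
  case True
  assume f: "f \<in> ell2 G"
  have "(\<Sum>\<^sub>\<infinity>i\<in>{i}. (cmod (f i))\<^sup>2) \<le> (\<Sum>\<^sub>\<infinity>i\<in>G. (cmod (f i))\<^sup>2)"
    using f True by (intro infsum_mono_neutral) (auto simp: ell2_def)
  then have "(cmod (f i))\<^sup>2 \<le> (\<Sum>\<^sub>\<infinity>i\<in>G. (cmod (f i))\<^sup>2)" by simp
  then show ?thesis by (simp add: ell2_norm_def real_le_rsqrt)
qed (auto simp: ell2_def ell2_norm_def infsum_nonneg)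

definition truncate :: "'i set \<Rightarrow> ('i \<Rightarrow> complex) \<Rightarrow> ('i \<Rightarrow> complex)" where
  "truncate F f = (\<lambda>i. if i \<in> F then f i else 0)"

definition unit_seq :: "'i \<Rightarrow> ('i \<Rightarrow> complex)" where
  "unit_seq j = (\<lambda>i. if i = j then 1 else 0)"

lemma truncate_ell2: "f \<in> ell2 G \<Longrightarrow> truncate F f \<in> ell2 G"
proof -
  assume f: "f \<in> ell2 G"
  have "(\<lambda>i. (cmod (truncate F f i))\<^sup>2) summable_on G"
    by (rule summable_on_comparison_test[where f = "\<lambda>i. (cmod (f i))\<^sup>2"])
      (use f in \<open>auto simp: ell2_def truncate_def\<close>)
  then show ?thesis using f by (auto simp: ell2_def truncate_def)
qed

lemma finite_support_ell2:
  assumes "finite F" "F \<subseteq> G" "\<And>i. i \<notin> F \<Longrightarrow> f i = 0"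
  shows "f \<in> ell2 G"
proof -
  have "(\<lambda>i. (cmod (f i))\<^sup>2) summable_on G \<longleftrightarrow> (\<lambda>i. (cmod (f i))\<^sup>2) summable_on F"
    by (rule summable_on_cong_neutral) (use assms in auto)
  then show ?thesis using assms by (auto simp: ell2_def)
qed

lemma truncate_tail_tendsto:
  assumes f: "f \<in> ell2 G"
  shows "((\<lambda>F. ell2_norm G (truncate (- F) f)) \<longlongrightarrow> 0) (finite_subsets_at_top G)"
proof -
  let ?g = "\<lambda>i. (cmod (f i))\<^sup>2"
  have sm: "?g summable_on G" using f by (simp add: ell2_def)
  have eq: "ell2_norm G (truncate (- F) f) = sqrt (infsum ?g G - sum ?g F)"
    if F: "finite F" "F \<subseteq> G" for F
  proof -
    have "(\<Sum>\<^sub>\<infinity>i\<in>G. (cmod (truncate (- F) f i))\<^sup>2) = infsum ?g (G - F)"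
      by (rule infsum_cong_neutral) (auto simp: truncate_def)
    also have "\<dots> = infsum ?g G - sum ?g F"
      using infsum_Diff[OF sm _ F(2)] F(1) by simp
    finally show ?thesis by (simp add: ell2_norm_def)
  qed
  have "(sum ?g \<longlongrightarrow> infsum ?g G) (finite_subsets_at_top G)"
    using infsum_tendsto[OF sm] .
  then have "((\<lambda>F. sqrt (infsum ?g G - sum ?g F)) \<longlongrightarrow> sqrt (infsum ?g G - infsum ?g G))
      (finite_subsets_at_top G)"
    by (intro tendsto_intros)
  then have "((\<lambda>F. sqrt (infsum ?g G - sum ?g F)) \<longlongrightarrow> 0) (finite_subsets_at_top G)" by simp
  then show ?thesis
    by (rule Lim_transform_eventually) (auto intro!: eventually_finite_subsets_at_top_weakI simp: eq)
qed

lemma bounded_op_truncate: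
  assumes T: "bounded_op G T" and F: "finite F" "F \<subseteq> G"
  shows "T (truncate F f) i = (\<Sum>j\<in>F. T (unit_seq j) i * f j)"
  using F
proof (induction F)
  case empty
  have "(0::'a \<Rightarrow> complex) \<in> ell2 G" by (rule finite_support_ell2[of "{}"]) auto
  then have "T (\<lambda>i. 0 * (0::'a \<Rightarrow> complex) i) = (\<lambda>i. 0 * T 0 i)"
    using T unfolding bounded_op_def by blast
  moreover have "truncate {} f = (\<lambda>i. 0)" by (auto simp: truncate_def)
  ultimately show ?case by simp
next
  case (insert j F)
  let ?u = "unit_seq j :: 'a \<Rightarrow> complex"
  have u: "?u \<in> ell2 G" "(\<lambda>i. f j * ?u i) \<in> ell2 G"
    by (rule finite_support_ell2[of "{j}"]; use insert in \<open>auto simp: unit_seq_def\<close>)+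
  have tr: "truncate F f \<in> ell2 G"
    by (rule finite_support_ell2[of F]) (use insert in \<open>auto simp: truncate_def\<close>)
  have "truncate (insert j F) f = truncate F f + (\<lambda>i. f j * ?u i)"
    using insert by (auto simp: truncate_def unit_seq_def fun_eq_iff)
  then have "T (truncate (insert j F) f) = T (truncate F f) + (\<lambda>i. f j * T ?u i)"
    using T u tr unfolding bounded_op_def by simp
  then show ?case using insert by (simp add: algebra_simps)
qed

lemma bounded_op_has_sum:
  assumes T: "bounded_op G T" and f: "f \<in> ell2 G"
  shows "((\<lambda>j. T (unit_seq j) i * f j) has_sum T f i) G"
proof -
  obtain K where K: "\<And>g. g \<in> ell2 G \<Longrightarrow> ell2_norm G (T g) \<le> K * ell2_norm G g"
    using T unfolding bounded_op_def by blast
  have est: "norm (T f i - (\<Sum>j\<in>F. T (unit_seq j) i * f j)) \<le> K * ell2_norm G (truncate (- F) f)"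
    if F: "finite F" "F \<subseteq> G" for F
  proof -
    have "truncate F f + truncate (- F) f = f" by (auto simp: truncate_def)
    then have "T f = T (truncate F f + truncate (- F) f)" by simp
    also have "\<dots> = T (truncate F f) + T (truncate (- F) f)"
      using T truncate_ell2[OF f] unfolding bounded_op_def by blast
    finally have "T f = T (truncate F f) + T (truncate (- F) f)" .
    then have "T f i - (\<Sum>j\<in>F. T (unit_seq j) i * f j) = T (truncate (- F) f) i"
      using bounded_op_truncate[OF T F, of f i] by simp
    moreover have "T (truncate (- F) f) \<in> ell2 G"
      using T truncate_ell2[OF f] unfolding bounded_op_def by blast
    ultimately show ?thesis
      using order_trans[OF ell2_coord_le K[OF truncate_ell2[OF f]]] by simp
  qed
  have "((\<lambda>F. K * ell2_norm G (truncate (- F) f)) \<longlongrightarrow> K * 0) (finite_subsets_at_top G)"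
    by (intro tendsto_intros truncate_tail_tendsto f)
  then have "((\<lambda>F. T f i - (\<Sum>j\<in>F. T (unit_seq j) i * f j)) \<longlongrightarrow> 0) (finite_subsets_at_top G)"
    by (intro Lim_null_comparison[OF eventually_finite_subsets_at_top_weakI[OF est]]) simp_all
  then have "((\<lambda>F. T f i - (T f i - (\<Sum>j\<in>F. T (unit_seq j) i * f j))) \<longlongrightarrow> T f i - 0)
      (finite_subsets_at_top G)"
    by (intro tendsto_intros)
  then show ?thesis by (simp add: has_sum_def)
qed

definition op_matrix :: "'i set \<Rightarrow> (('i \<Rightarrow> complex) \<Rightarrow> ('i \<Rightarrow> complex)) \<Rightarrow> 'i cmatrix" where
  "op_matrix G T = (\<lambda>i j. if i \<in> G \<and> j \<in> G then T (unit_seq j) i else 0)"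

lemma mat_apply_op_matrix:
  assumes T: "bounded_op G T" and f: "f \<in> ell2 G"
  shows "mat_apply G (op_matrix G T) f = T f"
proof
  fix i
  have "T f \<in> ell2 G" using T f unfolding bounded_op_def by blast
  then have "T f i = 0" if "i \<notin> G" using that by (simp add: ell2_def)
  moreover have "(\<Sum>\<^sub>\<infinity>j\<in>G. op_matrix G T i j * f j) = T f i" if "i \<in> G"
    using infsumI[OF bounded_op_has_sum[OF T f, of i]] that
    by (auto simp: op_matrix_def cong: infsum_cong)
  ultimately show "mat_apply G (op_matrix G T) f i = T f i"
    by (simp add: mat_apply_def)
qed

lemma op_matrix_bl_matrices:
  assumes T: "bounded_op G T"
  shows "op_matrix G T \<in> bl_matrices G"
proof -
  have cl: "f + g \<in> ell2 G" "(\<lambda>i. \<alpha> * f i) \<in> ell2 G" if f: "f \<in> ell2 G" and g: "g \<in> ell2 G" for f g \<alpha>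
  proof -
    have "(\<lambda>i. 2 * (cmod (f i))\<^sup>2 + 2 * (cmod (g i))\<^sup>2) summable_on G"
      using f g by (auto simp: ell2_def intro!: summable_on_add summable_on_cmult_right)
    moreover have "(cmod (f i + g i))\<^sup>2 \<le> 2 * (cmod (f i))\<^sup>2 + 2 * (cmod (g i))\<^sup>2" for i
    proof -
      have "(cmod (f i + g i))\<^sup>2 \<le> (cmod (f i) + cmod (g i))\<^sup>2"
        by (intro power_mono norm_triangle_ineq) auto
      also have "\<dots> \<le> 2 * (cmod (f i))\<^sup>2 + 2 * (cmod (g i))\<^sup>2"
        using sum_squares_bound[of "cmod (f i)" "cmod (g i)"] by (simp add: power2_sum)
      finally show ?thesis .
    qed
    ultimately have "(\<lambda>i. (cmod (f i + g i))\<^sup>2) summable_on G"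
      by (rule summable_on_comparison_test) auto
    then show "f + g \<in> ell2 G" using f g by (simp add: ell2_def)
    have "(\<lambda>i. (cmod \<alpha>)\<^sup>2 * (cmod (f i))\<^sup>2) summable_on G"
      using f by (auto simp: ell2_def intro!: summable_on_cmult_right)
    then show "(\<lambda>i. \<alpha> * f i) \<in> ell2 G"
      using f by (simp add: ell2_def norm_mult power_mult_distrib)
  qed
  have "bounded_op G (mat_apply G (op_matrix G T))"
    using T cl unfolding bounded_op_def by (simp add: mat_apply_op_matrix[OF T])
  moreover have "(\<lambda>j. op_matrix G T i j * f j) summable_on G" if "f \<in> ell2 G" "i \<in> G" for f i
  proof -
    have "(\<lambda>j. op_matrix G T i j * f j) summable_on G \<longleftrightarrow> (\<lambda>j. T (unit_seq j) i * f j) summable_on G"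
      by (rule summable_on_cong) (use that in \<open>simp add: op_matrix_def\<close>)
    then show ?thesis
      using bounded_op_has_sum[OF T that(1), of i] by (auto simp: summable_on_def)
  qed
  ultimately show ?thesis by (auto simp: bl_matrices_def matrices_def op_matrix_def)
qed

lemma mat_apply_unit_seq:
  assumes "i \<in> G" "j \<in> G"
  shows "mat_apply G A (unit_seq j) i = A i j"
proof -
  have "(\<Sum>\<^sub>\<infinity>k\<in>G. A i k * unit_seq j k) = (\<Sum>\<^sub>\<infinity>k\<in>{j}. A i k * unit_seq j k)"
    by (rule infsum_cong_neutral) (use assms in \<open>auto simp: unit_seq_def\<close>)
  then show ?thesis using assms by (simp add: mat_apply_def unit_seq_def)
qed

lemma unit_seq_ell2: "j \<in> G \<Longrightarrow> unit_seq j \<in> ell2 G"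
  by (rule finite_support_ell2[of "{j}"]) (auto simp: unit_seq_def)

theorem bounded_op_ex1_matrix:
  assumes T: "bounded_op G T"
  shows "\<exists>!A. A \<in> bl_matrices G \<and> (\<forall>f\<in>ell2 G. mat_apply G A f = T f)"
proof (rule ex1I[of _ "op_matrix G T"])
  show "op_matrix G T \<in> bl_matrices G \<and> (\<forall>f\<in>ell2 G. mat_apply G (op_matrix G T) f = T f)"
    using T by (simp add: op_matrix_bl_matrices mat_apply_op_matrix)
  fix A assume A: "A \<in> bl_matrices G \<and> (\<forall>f\<in>ell2 G. mat_apply G A f = T f)"
  show "A = op_matrix G T"
  proof (intro ext)
    fix i j
    show "A i j = op_matrix G T i j"
    proof (cases "i \<in> G \<and> j \<in> G")
      case True
      then show ?thesis
        using A mat_apply_unit_seq[of i G j A] unit_seq_ell2[of j G] by (auto simp: op_matrix_def)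
    next
      case False
      then show ?thesis using A by (auto simp: bl_matrices_def matrices_def op_matrix_def)
    qed
  qed
qed

theorem mat_apply_mult:
  assumes A: "A \<in> bl_matrices G" and B: "B \<in> bl_matrices G"
  shows "mat_mult G A B \<in> bl_matrices G"
    and "f \<in> ell2 G \<Longrightarrow> mat_apply G (mat_mult G A B) f = mat_apply G A (mat_apply G B f)"
proof -
  let ?T = "\<lambda>f. mat_apply G A (mat_apply G B f)"
  have bA: "bounded_op G (mat_apply G A)" and bB: "bounded_op G (mat_apply G B)"
    using A B by (auto simp: bl_matrices_def)
  have T: "bounded_op G ?T"
  proof -
    obtain K where K: "\<forall>f\<in>ell2 G. ell2_norm G (mat_apply G A f) \<le> K * ell2_norm G f"
      using bA unfolding bounded_op_def by blast
    obtain L where L: "\<forall>f\<in>ell2 G. ell2_norm G (mat_apply G B f) \<le> L * ell2_norm G f"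
      using bB unfolding bounded_op_def by blast
    have ran: "mat_apply G B f \<in> ell2 G" if "f \<in> ell2 G" for f
      using bB that unfolding bounded_op_def by blast
    have nn: "0 \<le> ell2_norm G f" for f by (simp add: ell2_norm_def infsum_nonneg)
    have "ell2_norm G (?T f) \<le> (\<bar>K\<bar> * L) * ell2_norm G f" if f: "f \<in> ell2 G" for f
    proof -
      have "ell2_norm G (?T f) \<le> K * ell2_norm G (mat_apply G B f)" using K ran[OF f] by blast
      also have "\<dots> \<le> \<bar>K\<bar> * ell2_norm G (mat_apply G B f)"
        by (intro mult_right_mono nn) auto
      also have "\<dots> \<le> \<bar>K\<bar> * (L * ell2_norm G f)"
        using L f by (intro mult_left_mono) auto
      finally show ?thesis by (simp add: mult.assoc)
    qed
    then have "\<exists>K. \<forall>f\<in>ell2 G. ell2_norm G (?T f) \<le> K * ell2_norm G f" by blast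
    then show ?thesis using bA bB unfolding bounded_op_def by simp
  qed
  have "op_matrix G ?T = mat_mult G A B"
  proof (intro ext)
    fix i j
    show "op_matrix G ?T i j = mat_mult G A B i j"
      by (auto simp: op_matrix_def mat_mult_def mat_apply_def[of G A] mat_apply_unit_seq
          intro!: infsum_cong)
  qed
  then show "mat_mult G A B \<in> bl_matrices G"
    and "f \<in> ell2 G \<Longrightarrow> mat_apply G (mat_mult G A B) f = ?T f"
    using op_matrix_bl_matrices[OF T] mat_apply_op_matrix[OF T] by auto
qed

end

theory Submission
  imports Defs
begin

text \<open>
  Only inverse-closedness of \<open>\<A>\<close> in the bounded operators needs proof.  If \<open>T \<in> \<A>\<close> has a bounded
  inverse, then \<open>R = I - t T\<^sup>* T\<close> has operator norm less than \<open>1\<close> for small \<open>t > 0\<close>.  The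
  differential inequality, applied to \<open>R\<close>, \<open>R\<^sup>2\<close>, \<open>R\<^sup>4\<close>, ..., shows that the \<open>\<A>\<close>-norms of these
  repeated squares tend to \<open>0\<close>.  Once the norm is small enough, completeness of \<open>\<A>\<close> yields a left
  inverse of \<open>I\<close> minus the square, and the factorisation \<open>I - P\<^sup>2 = (I + P) (I - P)\<close> carries it
  back to \<open>I - R = t T\<^sup>* T\<close>.  Hence \<open>T\<close> has a left inverse in \<open>\<A>\<close>, which must be its inverse.
\<close>

section \<open>The sequence space\<close>

lemma ell2_add:
  assumes "f \<in> ell2 G" "g \<in> ell2 G"
  shows "f + g \<in> ell2 G"
proof -
  have "(\<lambda>i. 2 * (cmod (f i))\<^sup>2 + 2 * (cmod (g i))\<^sup>2) summable_on G"
    using assms by (auto simp: ell2_def intro!: summable_on_add summable_on_cmult_right)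
  moreover have "(cmod (f i + g i))\<^sup>2 \<le> 2 * (cmod (f i))\<^sup>2 + 2 * (cmod (g i))\<^sup>2" for i
  proof -
    have "(cmod (f i + g i))\<^sup>2 \<le> (cmod (f i) + cmod (g i))\<^sup>2"
      by (intro power_mono norm_triangle_ineq) auto
    also have "\<dots> \<le> 2 * (cmod (f i))\<^sup>2 + 2 * (cmod (g i))\<^sup>2"
      using sum_squares_bound[of "cmod (f i)" "cmod (g i)"] by (simp add: power2_sum)
    finally show ?thesis .
  qed
  ultimately have "(\<lambda>i. (cmod (f i + g i))\<^sup>2) summable_on G"
    by (rule summable_on_comparison_test) auto
  then show ?thesis using assms by (simp add: ell2_def)
qed

lemma ell2_scale:
  assumes "f \<in> ell2 G"
  shows "(\<lambda>i. \<alpha> * f i) \<in> ell2 G"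
proof -
  have "(\<lambda>i. (cmod \<alpha>)\<^sup>2 * (cmod (f i))\<^sup>2) summable_on G"
    using assms by (auto simp: ell2_def intro!: summable_on_cmult_right)
  then show ?thesis
    using assms by (simp add: ell2_def norm_mult power_mult_distrib)
qed

lemma ell2_zero: "0 \<in> ell2 G"
  by (rule finite_support_ell2[of "{}"]) auto

lemma ell2_norm_nonneg: "0 \<le> ell2_norm G f"
  by (simp add: ell2_norm_def infsum_nonneg)

text \<open>On complex numbers \<open>inner\<close> is the Euclidean inner product of the plane, so
  this is the real part of the Hermitian inner product. It induces the same norm and still moves a
  matrix to its adjoint, as the contraction estimate requires.\<close>

definition ell2_inner :: "'i set \<Rightarrow> ('i \<Rightarrow> complex) \<Rightarrow> ('i \<Rightarrow> complex) \<Rightarrow> real" where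
  "ell2_inner G f g = (\<Sum>\<^sub>\<infinity>i\<in>G. inner (f i) (g i))"

lemma ell2_inner_summable:
  assumes "f \<in> ell2 G" "g \<in> ell2 G"
  shows "(\<lambda>i. inner (f i) (g i)) summable_on G"
proof -
  have "(\<lambda>i. (cmod (f i))\<^sup>2 + (cmod (g i))\<^sup>2) summable_on G"
    using assms by (auto simp: ell2_def intro!: summable_on_add)
  moreover have "norm (inner (f i) (g i)) \<le> (cmod (f i))\<^sup>2 + (cmod (g i))\<^sup>2" for i
  proof -
    have "\<bar>inner (f i) (g i)\<bar> \<le> cmod (f i) * cmod (g i)" by (rule Cauchy_Schwarz_ineq2)
    moreover have "2 * cmod (f i) * cmod (g i) \<le> (cmod (f i))\<^sup>2 + (cmod (g i))\<^sup>2"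
      by (rule sum_squares_bound)
    moreover have "0 \<le> cmod (f i) * cmod (g i)" by simp
    ultimately show ?thesis by simp
  qed
  ultimately have "(\<lambda>i. norm (inner (f i) (g i))) summable_on G"
    by (rule summable_on_comparison_test) auto
  then show ?thesis by (rule abs_summable_summable)
qed

lemma ell2_inner_commute: "ell2_inner G f g = ell2_inner G g f"
  by (simp add: ell2_inner_def inner_commute)

lemma ell2_inner_add_left:
  assumes "f \<in> ell2 G" "f' \<in> ell2 G" "g \<in> ell2 G"
  shows "ell2_inner G (f + f') g = ell2_inner G f g + ell2_inner G f' g"
  using assms by (simp add: ell2_inner_def inner_add_left infsum_add ell2_inner_summable)

lemma ell2_inner_scale_left:
  "ell2_inner G (\<lambda>i. complex_of_real x * f i) g = x * ell2_inner G f g"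
proof -
  have "inner (complex_of_real x * f i) (g i) = x * inner (f i) (g i)" for i
    by (simp add: inner_complex_def algebra_simps)
  then show ?thesis by (simp add: ell2_inner_def infsum_cmult_right')
qed

lemma ell2_norm_power2: "(ell2_norm G f)\<^sup>2 = ell2_inner G f f"
  by (simp add: ell2_norm_def ell2_inner_def infsum_nonneg power2_norm_eq_inner)

text \<open>Serves twice: as a quadratic in \<open>x\<close> for Cauchy-Schwarz, and at
  \<open>x = - (1 / K\<^sup>2)\<close> for the contraction estimate.\<close>

lemma ell2_norm_add_scale_power2:
  assumes "f \<in> ell2 G" "g \<in> ell2 G"
  shows "(ell2_norm G (f + (\<lambda>i. complex_of_real x * g i)))\<^sup>2 =
    (ell2_norm G f)\<^sup>2 + 2 * x * ell2_inner G f g + x\<^sup>2 * (ell2_norm G g)\<^sup>2"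
proof -
  define h where "h = (\<lambda>i. complex_of_real x * g i)"
  have h: "h \<in> ell2 G" unfolding h_def by (rule ell2_scale[OF assms(2)])
  have hl: "ell2_inner G h k = x * ell2_inner G g k" for k
    unfolding h_def by (rule ell2_inner_scale_left)
  have hr: "ell2_inner G k h = x * ell2_inner G k g" for k
    using hl[of k] by (simp only: ell2_inner_commute[of G k])
  have add_right: "ell2_inner G k (f + h) = ell2_inner G k f + ell2_inner G k h" if "k \<in> ell2 G" for k
    using ell2_inner_add_left[OF assms(1) h that]
    by (simp only: ell2_inner_commute[of G k])
  have "ell2_inner G (f + h) (f + h) = ell2_inner G f (f + h) + ell2_inner G h (f + h)"
    by (rule ell2_inner_add_left[OF assms(1) h ell2_add[OF assms(1) h]])
  also have "\<dots> = ell2_inner G f f + 2 * x * ell2_inner G f g + x\<^sup>2 * ell2_inner G g g"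
    by (simp add: add_right assms h hl hr ell2_inner_commute[of G g f] power2_eq_square algebra_simps)
  finally show ?thesis by (simp add: ell2_norm_power2 h_def)
qed

lemma ell2_Cauchy_Schwarz:
  assumes f: "f \<in> ell2 G" and g: "g \<in> ell2 G"
  shows "\<bar>ell2_inner G f g\<bar> \<le> ell2_norm G f * ell2_norm G g"
proof (cases "ell2_norm G g = 0")
  case True
  then have "g i = 0" for i using ell2_coord_le[OF g, of i] by simp
  then show ?thesis using True by (simp add: ell2_inner_def)
next
  case False
  let ?a = "ell2_inner G f g" and ?n = "ell2_norm G g"
  \<comment> \<open>The minimiser of the quadratic in \<open>x\<close>.\<close>
  define x where "x = - ?a / ?n\<^sup>2"
  have "0 \<le> (ell2_norm G f)\<^sup>2 + 2 * x * ?a + x\<^sup>2 * ?n\<^sup>2"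
    using ell2_norm_add_scale_power2[OF f g, of x] by (metis zero_le_power2)
  also have "\<dots> = (ell2_norm G f)\<^sup>2 - ?a\<^sup>2 / ?n\<^sup>2"
    using False by (simp add: x_def field_simps power2_eq_square)
  finally have "?a\<^sup>2 \<le> (ell2_norm G f * ?n)\<^sup>2"
    using False by (simp add: field_simps power_mult_distrib)
  then show ?thesis
    using ell2_norm_nonneg by (metis abs_le_square_iff abs_of_nonneg mult_nonneg_nonneg)
qed

lemma has_sum_finite_sum:
  fixes f :: "'a \<Rightarrow> 'b \<Rightarrow> 'c :: topological_comm_monoid_add"
  assumes "finite F" "\<And>j. j \<in> F \<Longrightarrow> (f j has_sum s j) G"
  shows "((\<lambda>i. \<Sum>j\<in>F. f j i) has_sum (\<Sum>j\<in>F. s j)) G"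
  using assms by (induction F) (auto intro: has_sum_add)

lemma infsum_inner_right:
  fixes f :: "'a \<Rightarrow> 'b :: real_inner"
  assumes "f summable_on G"
  shows "(\<Sum>\<^sub>\<infinity>i\<in>G. inner x (f i)) = inner x (infsum f G)"
  using has_sum_bounded_linear[OF bounded_linear_inner_right has_sum_infsum[OF assms]]
  by (auto intro: infsumI)

section \<open>Matrices of bounded operators\<close>

lemma bl_matricesD:
  assumes "A \<in> bl_matrices G"
  shows "A \<in> matrices G" "bounded_op G (mat_apply G A)"
    and "f \<in> ell2 G \<Longrightarrow> mat_apply G A f \<in> ell2 G"
  using assms by (auto simp: bl_matrices_def bounded_op_def)

lemma bl_summable:
  assumes "A \<in> bl_matrices G" "f \<in> ell2 G" "i \<in> G"
  shows "(\<lambda>j. A i j * f j) summable_on G"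
  using assms by (auto simp: bl_matrices_def)

text \<open>The bound in \<open>bounded_op\<close> may be any real, even negative if
  \<open>ell2 G\<close> is trivial. Bounds of at least 1 can be divided by and put
  \<open>1 - 1 / (K * L)\<^sup>2\<close> into \<open>[0, 1)\<close>.\<close>

lemma bounded_op_bound_ge_1:
  assumes "bounded_op G T"
  obtains K where "1 \<le> K" "\<And>f. f \<in> ell2 G \<Longrightarrow> ell2_norm G (T f) \<le> K * ell2_norm G f"
proof -
  obtain K where K: "\<And>f. f \<in> ell2 G \<Longrightarrow> ell2_norm G (T f) \<le> K * ell2_norm G f"
    using assms unfolding bounded_op_def by blast
  show ?thesis
    by (rule that[of "max 1 K"])
      (auto intro: order_trans[OF K mult_right_mono[OF _ ell2_norm_nonneg]])
qed

text \<open>Reduces identities between products to compositions of operators, so that no double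
  series has to be rearranged.\<close>

lemma bl_matrices_eqI:
  assumes "A \<in> bl_matrices G" "B \<in> bl_matrices G"
    and "\<And>f. f \<in> ell2 G \<Longrightarrow> mat_apply G A f = mat_apply G B f"
  shows "A = B"
  using bounded_op_ex1_matrix[OF bl_matricesD(2)[OF assms(2)]] assms by blast

lemma mat_apply_id: "f \<in> ell2 G \<Longrightarrow> mat_apply G (mat_id G) f = f"
proof
  fix i assume f: "f \<in> ell2 G"
  have "(\<Sum>\<^sub>\<infinity>j\<in>G. mat_id G i j * f j) = (\<Sum>\<^sub>\<infinity>j\<in>{i}. f j)" if "i \<in> G"
    by (rule infsum_cong_neutral) (use that in \<open>auto simp: mat_id_def\<close>)
  then show "mat_apply G (mat_id G) f i = f i"
    using f by (auto simp: mat_apply_def ell2_def)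
qed

lemma mat_apply_scale: "mat_apply G (mat_scale \<alpha> A) f = (\<lambda>i. \<alpha> * mat_apply G A f i)"
  by (auto simp: mat_apply_def mat_scale_def mult.assoc infsum_cmult_right')

lemma mat_apply_add:
  assumes "A \<in> bl_matrices G" "B \<in> bl_matrices G" "f \<in> ell2 G"
  shows "mat_apply G (A + B) f = mat_apply G A f + mat_apply G B f"
  using assms by (auto simp: mat_apply_def fun_eq_iff distrib_right infsum_add bl_summable)

lemma mat_apply_linear:
  assumes "A \<in> bl_matrices G"
  shows "f \<in> ell2 G \<Longrightarrow> g \<in> ell2 G \<Longrightarrow> mat_apply G A (f + g) = mat_apply G A f + mat_apply G A g"
    and "f \<in> ell2 G \<Longrightarrow> mat_apply G A (\<lambda>i. \<alpha> * f i) = (\<lambda>i. \<alpha> * mat_apply G A f i)"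
  using bl_matricesD(2)[OF assms] unfolding bounded_op_def by blast+

lemma mat_minus_eq: "A - B = A + mat_scale (-1) (B :: 'i cmatrix)"
  by (auto simp: mat_scale_def fun_eq_iff)

section \<open>Bounds on the operator norm\<close>

lemma op_norm_nonneg:
  assumes "A \<in> bl_matrices G"
  shows "0 \<le> op_norm G A"
proof -
  obtain K where K: "1 \<le> K" "\<And>f. f \<in> ell2 G \<Longrightarrow> ell2_norm G (mat_apply G A f) \<le> K * ell2_norm G f"
    using bounded_op_bound_ge_1[OF bl_matricesD(2)[OF assms]] by blast
  \<comment> \<open>A real supremum dominates its members only if the set is bounded above.\<close>
  have "bdd_above ((\<lambda>f. ell2_norm G (mat_apply G A f)) ` {f \<in> ell2 G. ell2_norm G f \<le> 1})"
  proof (rule bdd_aboveI2)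
    fix f assume "f \<in> {f \<in> ell2 G. ell2_norm G f \<le> 1}"
    then have "ell2_norm G (mat_apply G A f) \<le> K * ell2_norm G f" "K * ell2_norm G f \<le> K * 1"
      using K by (auto intro!: mult_left_mono)
    then show "ell2_norm G (mat_apply G A f) \<le> K" by simp
  qed
  moreover have "0 \<in> {f \<in> ell2 G. ell2_norm G f \<le> 1}"
    by (simp add: ell2_zero ell2_norm_def)
  ultimately have "ell2_norm G (mat_apply G A 0) \<le> op_norm G A"
    unfolding op_norm_def by (intro cSUP_upper)
  then show ?thesis using ell2_norm_nonneg order_trans by blast
qed

lemma op_norm_leI:
  assumes "0 \<le> K" "\<And>f. f \<in> ell2 G \<Longrightarrow> ell2_norm G (mat_apply G A f) \<le> K * ell2_norm G f"
  shows "op_norm G A \<le> K"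
  unfolding op_norm_def
proof (rule cSUP_least)
  have "0 \<in> {f \<in> ell2 G. ell2_norm G f \<le> 1}"
    by (simp add: ell2_zero ell2_norm_def)
  then show "{f \<in> ell2 G. ell2_norm G f \<le> 1} \<noteq> {}" by blast
  fix f assume "f \<in> {f \<in> ell2 G. ell2_norm G f \<le> 1}"
  then have "ell2_norm G (mat_apply G A f) \<le> K * ell2_norm G f" "K * ell2_norm G f \<le> K * 1"
    using assms by (blast, intro mult_left_mono) auto
  then show "ell2_norm G (mat_apply G A f) \<le> K" by simp
qed

section \<open>Adjoint matrices and the inner product\<close>

lemma ell2_inner_mat_apply_truncate:
  assumes A: "A \<in> bl_matrices G" and A': "mat_adj A \<in> bl_matrices G"
    and g: "g \<in> ell2 G" and F: "finite F" "F \<subseteq> G"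
  shows "ell2_inner G (mat_apply G A (truncate F f)) g
    = ell2_inner G (truncate F f) (mat_apply G (mat_adj A) g)"
proof -
  \<comment> \<open>Multiplication by a complex number has multiplication by its conjugate as
    adjoint, also for the real inner product.\<close>
  have adj: "inner (A i j * f j) (g i) = inner (f j) (mat_adj A j i * g i)" for i j
    by (simp add: mat_adj_def inner_complex_def algebra_simps)
  have sm: "(\<lambda>i. mat_adj A j i * g i) summable_on G" if "j \<in> F" for j
    using bl_summable[OF A' g] that F by blast
  have "ell2_inner G (mat_apply G A (truncate F f)) g
      = (\<Sum>\<^sub>\<infinity>i\<in>G. \<Sum>j\<in>F. inner (f j) (mat_adj A j i * g i))"
    unfolding ell2_inner_def
  proof (rule infsum_cong)
    fix i assume "i \<in> G"
    have "mat_apply G A (truncate F f) i = (\<Sum>j\<in>F. A i j * f j)"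
      unfolding bounded_op_truncate[OF bl_matricesD(2)[OF A] F]
      by (rule sum.cong) (use F \<open>i \<in> G\<close> in \<open>auto simp: mat_apply_unit_seq\<close>)
    then show "inner (mat_apply G A (truncate F f) i) (g i)
        = (\<Sum>j\<in>F. inner (f j) (mat_adj A j i * g i))"
      by (simp add: inner_sum_left adj)
  qed
  \<comment> \<open>The truncation makes the sum over \<open>j\<close> finite, so the interchange is
    just additivity of \<open>has_sum\<close>.\<close>
  also have "\<dots> = (\<Sum>j\<in>F. \<Sum>\<^sub>\<infinity>i\<in>G. inner (f j) (mat_adj A j i * g i))"
    by (intro infsumI has_sum_finite_sum F has_sum_infsum
        summable_on_bounded_linear[OF bounded_linear_inner_right] sm)
  also have "\<dots> = (\<Sum>j\<in>F. inner (f j) (mat_apply G (mat_adj A) g j))"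
    using F by (intro sum.cong)
      (auto simp: mat_apply_def infsum_inner_right sm)
  also have "\<dots> = (\<Sum>\<^sub>\<infinity>j\<in>F. inner (f j) (mat_apply G (mat_adj A) g j))"
    using F by simp
  also have "\<dots> = ell2_inner G (truncate F f) (mat_apply G (mat_adj A) g)"
    unfolding ell2_inner_def
    by (rule infsum_cong_neutral) (use F in \<open>auto simp: truncate_def\<close>)
  finally show ?thesis .
qed

text \<open>A density argument: the identity holds for truncations of \<open>f\<close>, and both
  sides change by at most a constant times the norm of the tail.\<close>

lemma ell2_inner_mat_apply_left:
  assumes A: "A \<in> bl_matrices G" and A': "mat_adj A \<in> bl_matrices G"
    and f: "f \<in> ell2 G" and g: "g \<in> ell2 G"
  shows "ell2_inner G (mat_apply G A f) g = ell2_inner G f (mat_apply G (mat_adj A) g)"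
proof -
  let ?h = "mat_apply G (mat_adj A) g"
  obtain K where K: "1 \<le> K" "\<And>f. f \<in> ell2 G \<Longrightarrow> ell2_norm G (mat_apply G A f) \<le> K * ell2_norm G f"
    using bounded_op_bound_ge_1[OF bl_matricesD(2)[OF A]] by blast
  have h: "?h \<in> ell2 G" by (rule bl_matricesD(3)[OF A' g])
  define \<delta> where "\<delta> = ell2_inner G (mat_apply G A f) g - ell2_inner G f ?h"
  have est: "norm \<delta> \<le> (K * ell2_norm G g + ell2_norm G ?h) * ell2_norm G (truncate (- F) f)"
    if F: "finite F" "F \<subseteq> G" for F
  proof -
    let ?a = "truncate F f" and ?b = "truncate (- F) f"
    have ab: "?a \<in> ell2 G" "?b \<in> ell2 G" by (rule truncate_ell2[OF f])+
    have split: "f = ?a + ?b" by (auto simp: truncate_def)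
    have "mat_apply G A f = mat_apply G A ?a + mat_apply G A ?b"
      by (subst split) (rule mat_apply_linear(1)[OF A ab])
    then have "ell2_inner G (mat_apply G A f) g
        = ell2_inner G (mat_apply G A ?a) g + ell2_inner G (mat_apply G A ?b) g"
      using ab g by (simp add: ell2_inner_add_left bl_matricesD(3)[OF A])
    moreover have "ell2_inner G f ?h = ell2_inner G ?a ?h + ell2_inner G ?b ?h"
      by (subst split) (rule ell2_inner_add_left[OF ab h])
    ultimately have \<delta>: "\<delta> = ell2_inner G (mat_apply G A ?b) g - ell2_inner G ?b ?h"
      using ell2_inner_mat_apply_truncate[OF A A' g F, of f] by (simp add: \<delta>_def)
    have "\<bar>ell2_inner G (mat_apply G A ?b) g\<bar> \<le> ell2_norm G (mat_apply G A ?b) * ell2_norm G g"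
      by (rule ell2_Cauchy_Schwarz[OF bl_matricesD(3)[OF A ab(2)] g])
    also have "\<dots> \<le> (K * ell2_norm G ?b) * ell2_norm G g"
      by (rule mult_right_mono[OF K(2)[OF ab(2)] ell2_norm_nonneg])
    finally show ?thesis
      using ell2_Cauchy_Schwarz[OF ab(2) h] by (simp add: \<delta> algebra_simps)
  qed
  have "((\<lambda>F. (K * ell2_norm G g + ell2_norm G ?h) * ell2_norm G (truncate (- F) f))
      \<longlongrightarrow> (K * ell2_norm G g + ell2_norm G ?h) * 0) (finite_subsets_at_top G)"
    by (intro tendsto_intros truncate_tail_tendsto f)
  \<comment> \<open>\<open>\<delta>\<close> does not depend on \<open>F\<close>, so being dominated
    by a null net forces it to vanish.\<close>
  then have "((\<lambda>F. \<delta>) \<longlongrightarrow> 0) (finite_subsets_at_top G)"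
    by (intro Lim_null_comparison[OF eventually_finite_subsets_at_top_weakI[OF est]]) simp_all
  then have "\<delta> = 0" by (simp add: tendsto_const_iff)
  then show ?thesis by (simp add: \<delta>_def)
qed

text \<open>
  With \<open>t = 1 / K\<^sup>2\<close>, expanding the square and using \<open>\<langle>f, T\<^sup>* T f\<rangle> = \<parallel>T f\<parallel>\<^sup>2\<close> gives
  \<open>\<parallel>f - t T\<^sup>* T f\<parallel>\<^sup>2 \<le> \<parallel>f\<parallel>\<^sup>2 - t \<parallel>T f\<parallel>\<^sup>2\<close>.
\<close>

lemma normal_operator_contraction:
  assumes T: "T \<in> bl_matrices G" and T': "mat_adj T \<in> bl_matrices G"
    and K: "1 \<le> K" "\<And>f. f \<in> ell2 G \<Longrightarrow> ell2_norm G (mat_apply G (mat_adj T) f) \<le> K * ell2_norm G f"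
    and L: "1 \<le> L" "\<And>f. f \<in> ell2 G \<Longrightarrow> ell2_norm G f \<le> L * ell2_norm G (mat_apply G T f)"
    and f: "f \<in> ell2 G"
  shows "ell2_norm G (f + (\<lambda>i. complex_of_real (- (1 / K\<^sup>2)) *
      mat_apply G (mat_adj T) (mat_apply G T f) i))
    \<le> sqrt (1 - 1 / (K * L)\<^sup>2) * ell2_norm G f"
proof -
  define g where "g = mat_apply G T f"
  define h where "h = mat_apply G (mat_adj T) g"
  have g: "g \<in> ell2 G" unfolding g_def by (rule bl_matricesD(3)[OF T f])
  have h: "h \<in> ell2 G" unfolding h_def by (rule bl_matricesD(3)[OF T' g])
  have ip: "ell2_inner G f h = (ell2_norm G g)\<^sup>2"
    using ell2_inner_mat_apply_left[OF T T' f g] by (simp add: ell2_norm_power2 g_def h_def)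
  have "(ell2_norm G h)\<^sup>2 \<le> (K * ell2_norm G g)\<^sup>2"
    unfolding h_def by (rule power_mono[OF K(2)[OF g] ell2_norm_nonneg])
  then have "(1 / K\<^sup>2)\<^sup>2 * (ell2_norm G h)\<^sup>2 \<le> (1 / K\<^sup>2)\<^sup>2 * (K * ell2_norm G g)\<^sup>2"
    by (rule mult_left_mono) simp
  also have "\<dots> = 1 / K\<^sup>2 * (ell2_norm G g)\<^sup>2"
    using K(1) by (simp add: power_mult_distrib power2_eq_square)
  finally have h_le: "(1 / K\<^sup>2)\<^sup>2 * (ell2_norm G h)\<^sup>2 \<le> 1 / K\<^sup>2 * (ell2_norm G g)\<^sup>2" .
  \<comment> \<open>As \<open>T\<close> is bounded below, the gain in terms of \<open>T f\<close> is
    a fixed fraction of the squared norm of \<open>f\<close>.\<close>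
  have "(ell2_norm G f)\<^sup>2 \<le> (L * ell2_norm G g)\<^sup>2"
    unfolding g_def by (rule power_mono[OF L(2)[OF f] ell2_norm_nonneg])
  then have "1 / (K * L)\<^sup>2 * (ell2_norm G f)\<^sup>2 \<le> 1 / (K * L)\<^sup>2 * (L * ell2_norm G g)\<^sup>2"
    by (rule mult_left_mono) simp
  also have "\<dots> = 1 / K\<^sup>2 * (ell2_norm G g)\<^sup>2"
    using L(1) by (simp add: power_mult_distrib)
  finally have g_ge: "1 / (K * L)\<^sup>2 * (ell2_norm G f)\<^sup>2 \<le> 1 / K\<^sup>2 * (ell2_norm G g)\<^sup>2" .
  have "(ell2_norm G (f + (\<lambda>i. complex_of_real (- (1 / K\<^sup>2)) * h i)))\<^sup>2
      \<le> (1 - 1 / (K * L)\<^sup>2) * (ell2_norm G f)\<^sup>2"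
    unfolding ell2_norm_add_scale_power2[OF f h] ip power2_minus left_diff_distrib
    using h_le g_ge by linarith
  then have "ell2_norm G (f + (\<lambda>i. complex_of_real (- (1 / K\<^sup>2)) * h i))
      \<le> sqrt ((1 - 1 / (K * L)\<^sup>2) * (ell2_norm G f)\<^sup>2)"
    by (rule real_le_rsqrt)
  also have "\<dots> = sqrt (1 - 1 / (K * L)\<^sup>2) * ell2_norm G f"
    by (simp add: real_sqrt_mult ell2_norm_nonneg)
  finally show ?thesis by (simp only: g_def h_def)
qed

section \<open>Ring laws for the matrix product\<close>

lemma mat_mult_id:
  assumes "A \<in> bl_matrices G" "mat_id G \<in> bl_matrices G"
  shows "mat_mult G (mat_id G) A = A" "mat_mult G A (mat_id G) = A"
  by (rule bl_matrices_eqI[of _ G];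
      use assms in \<open>simp add: mat_apply_mult mat_apply_id bl_matricesD(3)\<close>)+

lemma mat_mult_assoc:
  assumes "A \<in> bl_matrices G" "B \<in> bl_matrices G" "C \<in> bl_matrices G"
  shows "mat_mult G (mat_mult G A B) C = mat_mult G A (mat_mult G B C)"
  by (rule bl_matrices_eqI[of _ G])
    (use assms in \<open>simp_all add: mat_apply_mult bl_matricesD(3)\<close>)

lemma mat_mult_add:
  assumes "A \<in> bl_matrices G" "B \<in> bl_matrices G" "C \<in> bl_matrices G"
  shows "mat_mult G (A + B) C = mat_mult G A C + mat_mult G B C"
    and "mat_mult G C (A + B) = mat_mult G C A + mat_mult G C B"
proof -
  have s: "(\<lambda>k. A i k * C k j) summable_on G" "(\<lambda>k. B i k * C k j) summable_on G"
    "(\<lambda>k. C i k * A k j) summable_on G" "(\<lambda>k. C i k * B k j) summable_on G"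
    if "i \<in> G" "j \<in> G" for i j
  proof -
    \<comment> \<open>Column \<open>j\<close> of \<open>Q\<close> is the image of a unit sequence,
      hence in \<open>ell2 G\<close>, and row \<open>i\<close> of \<open>P\<close> is summable
      against any such sequence.\<close>
    have col: "(\<lambda>k. P i k * Q k j) summable_on G" if P: "P \<in> bl_matrices G" and Q: "Q \<in> bl_matrices G" for P Q
    proof -
      have "mat_apply G Q (unit_seq j) \<in> ell2 G"
        by (rule bl_matricesD(3)[OF Q unit_seq_ell2[OF \<open>j \<in> G\<close>]])
      from bl_summable[OF P this \<open>i \<in> G\<close>] show ?thesis
        by (rule summable_on_cong[THEN iffD1, rotated])
          (simp add: mat_apply_unit_seq \<open>j \<in> G\<close>)
    qed
    show "(\<lambda>k. A i k * C k j) summable_on G" "(\<lambda>k. B i k * C k j) summable_on G"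
      "(\<lambda>k. C i k * A k j) summable_on G" "(\<lambda>k. C i k * B k j) summable_on G"
      by (intro col assms)+
  qed
  show "mat_mult G (A + B) C = mat_mult G A C + mat_mult G B C"
    "mat_mult G C (A + B) = mat_mult G C A + mat_mult G C B"
    by (auto simp: mat_mult_def fun_eq_iff distrib_left distrib_right infsum_add s)
qed

text \<open>Holds for arbitrary matrices: a nonzero factor preserves summability and its failure,
  and a divergent \<open>infsum\<close> is 0.\<close>

lemma mat_mult_scale:
  "mat_mult G (mat_scale \<alpha> A) B = mat_scale \<alpha> (mat_mult G A B)"
  "mat_mult G A (mat_scale \<alpha> B) = mat_scale \<alpha> (mat_mult G A B)"
  by (auto simp: mat_mult_def mat_scale_def fun_eq_iff mult.assoc mult.left_commute infsum_cmult_right')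

section \<open>Inverse-closedness\<close>

text \<open>
  Writing \<open>a k = c k * s ^ (2 ^ k)\<close> turns the recursion into \<open>c (k + 1) \<le> D * c k powr (2 - \<theta>)\<close>,
  so \<open>ln (c k)\<close> grows like \<open>k * (2 - \<theta>) ^ k\<close>, which is dominated by \<open>2 ^ k\<close>.
\<close>

lemma squaring_recursion_tendsto_0:
  fixes a :: "nat \<Rightarrow> real"
  assumes \<theta>: "0 < \<theta>" "\<theta> \<le> 1" and s: "0 < s" "s < 1" and a0: "\<And>k. 0 \<le> a k"
    and rec: "\<And>k. a (Suc k) \<le> D * a k powr (2 - \<theta>) * (s ^ (2 ^ k)) powr \<theta>"
  shows "a \<longlonglongrightarrow> 0"
proof -
  define \<gamma> where "\<gamma> = 2 - \<theta>"
  \<comment> \<open>Large enough for the start (\<open>a 0 / s\<close>), for the recursion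
    (\<open>D\<close>), and for powers of \<open>E\<close> to increase with the exponent
    (1).\<close>
  define E where "E = max 1 (max D (a 0 / s))"
  have \<gamma>: "1 \<le> \<gamma>" "\<gamma> < 2" using \<theta> by (auto simp: \<gamma>_def)
  have E: "1 \<le> E" "D \<le> E" "a 0 / s \<le> E" by (auto simp: E_def)
  \<comment> \<open>The summand 1 in \<open>real k + 1\<close> supplies the factor \<open>E\<close>
    at \<open>k = 0\<close>. Each step adds 1 to the exponent, which
    \<open>\<gamma> ^ Suc k \<ge> 1\<close> absorbs.\<close>
  have bound: "a k \<le> E powr (\<gamma> ^ k * (real k + 1)) * s powr (2 ^ k)" for k
  proof (induction k)
    case 0
    show ?case using E s by (simp add: field_simps)
  next
    case (Suc k)
    have "a (Suc k) \<le> D * a k powr \<gamma> * (s ^ (2 ^ k)) powr \<theta>"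
      using rec[of k] by (simp add: \<gamma>_def)
    also have "\<dots> \<le> E * a k powr \<gamma> * (s ^ (2 ^ k)) powr \<theta>"
      using E by (intro mult_right_mono) auto
    also have "\<dots> \<le> E * (E powr (\<gamma> ^ k * (real k + 1)) * s powr (2 ^ k)) powr \<gamma> * (s ^ (2 ^ k)) powr \<theta>"
      using E \<gamma> Suc a0 by (intro mult_right_mono mult_left_mono powr_mono2) auto
    also have "(s ^ (2 ^ k)) powr \<theta> = s powr (2 ^ k * \<theta>)"
      using s by (simp add: powr_powr flip: powr_realpow)
    also have "E * (E powr (\<gamma> ^ k * (real k + 1)) * s powr (2 ^ k)) powr \<gamma> * s powr (2 ^ k * \<theta>)
        = E powr (1 + \<gamma> ^ k * (real k + 1) * \<gamma>) * (s powr (2 ^ k * \<gamma>) * s powr (2 ^ k * \<theta>))"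
      using E s by (simp add: powr_mult powr_powr powr_add)
    \<comment> \<open>Since \<open>\<gamma> + \<theta> = 2\<close>, the exponent of \<open>s\<close>
      exactly doubles.\<close>
    also have "s powr (2 ^ k * \<gamma>) * s powr (2 ^ k * \<theta>) = s powr (2 ^ Suc k)"
      by (simp add: \<gamma>_def algebra_simps flip: powr_add)
    also have "E powr (1 + \<gamma> ^ k * (real k + 1) * \<gamma>) \<le> E powr (\<gamma> ^ Suc k * (real (Suc k) + 1))"
      using E one_le_power[OF \<gamma>(1), of "Suc k"] by (intro powr_mono) (auto simp: algebra_simps)
    finally show ?case using mult_right_mono by fastforce
  qed
  \<comment> \<open>This is the logarithm of the bound divided by \<open>2 ^ k\<close>. As
    \<open>\<gamma> < 2\<close>, the terms with \<open>ln E\<close> die out and the negative limit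
    \<open>ln s\<close> remains.\<close>
  have "(\<lambda>k. (of_nat k * (\<gamma> / 2) ^ k + (\<gamma> / 2) ^ k) * ln E + ln s) \<longlonglongrightarrow> (0 + 0) * ln E + ln s"
    using \<gamma> by (intro tendsto_intros powser_times_n_limit_0 LIMSEQ_power_zero) auto
  then have lim: "(\<lambda>k. (of_nat k * (\<gamma> / 2) ^ k + (\<gamma> / 2) ^ k) * ln E + ln s) \<longlonglongrightarrow> ln s"
    by simp
  have "filterlim (\<lambda>k. (2::real) ^ k) at_top sequentially"
    by (intro filterlim_at_infinity_imp_filterlim_at_top filterlim_realpow_sequentially_gt1) auto
  with lim have "filterlim (\<lambda>k. ((of_nat k * (\<gamma> / 2) ^ k + (\<gamma> / 2) ^ k) * ln E + ln s) * 2 ^ k)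
      at_bot sequentially"
    using s by (intro filterlim_tendsto_neg_mult_at_bot) auto
  then have "(\<lambda>k. exp (((of_nat k * (\<gamma> / 2) ^ k + (\<gamma> / 2) ^ k) * ln E + ln s) * 2 ^ k)) \<longlonglongrightarrow> 0"
    by (rule filterlim_compose[OF exp_at_bot])
  moreover have "exp (((of_nat k * (\<gamma> / 2) ^ k + (\<gamma> / 2) ^ k) * ln E + ln s) * 2 ^ k)
      = E powr (\<gamma> ^ k * (real k + 1)) * s powr (2 ^ k)" for k
  proof -
    have "((of_nat k * (\<gamma> / 2) ^ k + (\<gamma> / 2) ^ k) * ln E + ln s) * 2 ^ k
        = \<gamma> ^ k * (real k + 1) * ln E + 2 ^ k * ln s"
      by (simp add: power_divide field_simps)
    then show ?thesis using E s by (simp add: powr_def exp_add)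
  qed
  ultimately have "(\<lambda>k. E powr (\<gamma> ^ k * (real k + 1)) * s powr (2 ^ k)) \<longlonglongrightarrow> 0" by simp
  then show ?thesis
    by (rule real_tendsto_sandwich[OF _ _ tendsto_const, rotated 2]) (auto simp: a0 bound)
qed

context q_banach_space
begin

lemma diff_closed: "A \<in> \<A> \<Longrightarrow> B \<in> \<A> \<Longrightarrow> A - B \<in> \<A>"
  by (simp only: mat_minus_eq add_closed scale_closed)

end

context proper_q_banach_algebra
begin

lemma bl: "A \<in> \<A> \<Longrightarrow> A \<in> bl_matrices G"
  using subset_bl by blast

lemma mat_mult_diff:
  assumes "A \<in> \<A>" "B \<in> \<A>" "C \<in> \<A>"
  shows "mat_mult G (A - B) C = mat_mult G A C - mat_mult G B C"
    and "mat_mult G C (A - B) = mat_mult G C A - mat_mult G C B"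
  using assms by (simp_all add: mat_minus_eq mat_mult_add mat_mult_scale bl scale_closed)

text \<open>The fixed point equation \<open>X = I + X P\<close> says that \<open>X\<close> is a left inverse of \<open>I - P\<close>.\<close>

lemma left_inverse_id_minus:
  assumes P: "P \<in> \<A>" and K: "0 < K" "\<And>A B. A \<in> \<A> \<Longrightarrow> B \<in> \<A> \<Longrightarrow> N (mat_mult G A B) \<le> K * N A * N B"
    and small: "K * N P < 1"
  shows "\<exists>X\<in>\<A>. mat_mult G X (mat_id G - P) = mat_id G"
proof -
  interpret M: Metric_space \<A> "qdist \<A> N q" by (rule Metric_space_qdist)
  let ?F = "\<lambda>X. mat_id G + mat_mult G X P"
  have F: "?F X \<in> \<A>" if "X \<in> \<A>" for X
    by (rule add_closed[OF id_closed mult_closed[OF that P]])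
  have KP: "0 \<le> K * N P" using K(1) norm_nonneg[OF P] by simp
  \<comment> \<open>The metric is the \<open>q\<close>-th power of \<open>N\<close>, so the
    contraction factor is a \<open>q\<close>-th power too; this makes the fixed point argument work
    for \<open>q < 1\<close>.\<close>
  have contr: "qdist \<A> N q (?F X) (?F Y) \<le> (K * N P) powr q * qdist \<A> N q X Y"
    if X: "X \<in> \<A>" and Y: "Y \<in> \<A>" for X Y
  proof -
    have XY: "X - Y \<in> \<A>" by (rule diff_closed[OF X Y])
    have "?F X - ?F Y = mat_mult G (X - Y) P"
      by (simp add: mat_mult_diff(1)[OF X Y P])
    then have "N (?F X - ?F Y) \<le> (K * N P) * N (X - Y)"
      using K(2)[OF XY P] by (simp add: mult_ac)
    then have "N (?F X - ?F Y) powr q \<le> ((K * N P) * N (X - Y)) powr q"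
      using q_pos by (intro powr_mono2 norm_nonneg diff_closed F X Y) auto
    then show ?thesis
      using X Y F KP norm_nonneg[OF XY] by (simp add: qdist_def powr_mult)
  qed
  have "(K * N P) powr q < 1 powr q"
    using KP small q_pos by (intro powr_less_mono2) auto
  then obtain X where X: "X \<in> \<A>" "?F X = X"
    using M.Banach_fixedpoint_thm[OF complete, of ?F "(K * N P) powr q"] F contr zero_closed
    by auto
  have "mat_mult G X (mat_id G - P) = X - mat_mult G X P"
    by (simp add: mat_mult_diff id_closed X(1) P mat_mult_id bl)
  also have "\<dots> = ?F X - mat_mult G X P" by (simp only: X(2))
  also have "\<dots> = mat_id G" by simp
  finally show ?thesis using X(1) by blast
qed

lemma left_inverse_id_minus_square:
  assumes P: "P \<in> \<A>" and X: "X \<in> \<A>" "mat_mult G X (mat_id G - mat_mult G P P) = mat_id G"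
  shows "\<exists>Y\<in>\<A>. mat_mult G Y (mat_id G - P) = mat_id G"
proof -
  have "mat_mult G (mat_id G + P) (mat_id G - P) = mat_id G - mat_mult G P P"
    by (simp add: mat_mult_diff mat_mult_add mat_mult_id id_closed P bl add_closed)
  then have "mat_mult G (mat_mult G X (mat_id G + P)) (mat_id G - P) = mat_id G"
    by (simp add: mat_mult_assoc bl X P id_closed add_closed diff_closed)
  then show ?thesis
    using X P by (intro bexI[of _ "mat_mult G X (mat_id G + P)"] mult_closed add_closed id_closed)
qed

section \<open>Norms of repeated squares\<close>

lemma repeated_square_closed: "R \<in> \<A> \<Longrightarrow> ((\<lambda>P. mat_mult G P P) ^^ k) R \<in> \<A>"
  by (induction k) (auto intro: mult_closed)

text \<open>The induction is on the pointwise estimate with \<open>f\<close> arbitrary, because the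
  hypothesis is applied both to \<open>f\<close> and to its image; the supremum is taken only at the
  end.\<close>

lemma repeated_square_op_norm_le:
  assumes R: "R \<in> \<A>" and r: "0 \<le> r" "\<And>f. f \<in> ell2 G \<Longrightarrow> ell2_norm G (mat_apply G R f) \<le> r * ell2_norm G f"
  shows "op_norm G (((\<lambda>P. mat_mult G P P) ^^ k) R) \<le> r ^ (2 ^ k)"
proof (rule op_norm_leI)
  fix f assume "f \<in> ell2 G"
  then show "ell2_norm G (mat_apply G (((\<lambda>P. mat_mult G P P) ^^ k) R) f) \<le> r ^ (2 ^ k) * ell2_norm G f"
  proof (induction k arbitrary: f)
    case (Suc k)
    let ?P = "((\<lambda>P. mat_mult G P P) ^^ k) R"
    have P: "?P \<in> bl_matrices G" by (intro bl repeated_square_closed R)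
    have "ell2_norm G (mat_apply G ?P (mat_apply G ?P f)) \<le> r ^ (2 ^ k) * ell2_norm G (mat_apply G ?P f)"
      by (rule Suc.IH[OF bl_matricesD(3)[OF P Suc.prems]])
    also have "\<dots> \<le> r ^ (2 ^ k) * (r ^ (2 ^ k) * ell2_norm G f)"
      using r(1) by (intro mult_left_mono Suc) auto
    finally show ?case
      by (simp add: mat_apply_mult(2)[OF P P Suc.prems] power_mult mult_2 power_add mult.assoc)
  qed (simp add: r)
qed (use r in simp)

text \<open>The differential inequality with \<open>A = B\<close> has two equal summands, hence the
  constant \<open>2 * D\<close>. Taking \<open>q\<close>-th powers of \<open>N\<close> and of
  \<open>r\<close> gives the recursion of \<open>squaring_recursion_tendsto_0\<close>.\<close>

lemma repeated_square_tendsto_0: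
  assumes R: "R \<in> \<A>" and r: "0 < r" "r < 1"
    "\<And>f. f \<in> ell2 G \<Longrightarrow> ell2_norm G (mat_apply G R f) \<le> r * ell2_norm G f"
  shows "(\<lambda>k. N (((\<lambda>P. mat_mult G P P) ^^ k) R) powr q) \<longlonglongrightarrow> 0"
proof -
  let ?P = "\<lambda>k. ((\<lambda>P. mat_mult G P P) ^^ k) R"
  obtain \<theta> D where \<theta>: "0 < \<theta>" "\<theta> \<le> 1" and D: "0 < D"
    and diff: "\<And>A B. A \<in> \<A> \<Longrightarrow> B \<in> \<A> \<Longrightarrow> N (mat_mult G A B) powr q \<le> D * N A powr q * N B powr q *
        ((op_norm G A / N A) powr (q * \<theta>) + (op_norm G B / N B) powr (q * \<theta>))"
    using differential by blast
  have P: "?P k \<in> \<A>" for k by (rule repeated_square_closed[OF R])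
  show ?thesis
  proof (rule squaring_recursion_tendsto_0[OF \<theta>, of "r powr q" _ "2 * D"])
    show "0 < r powr q" using r by simp
    show "r powr q < 1" using powr_less_mono2[of q r 1] r q_pos by simp
    fix k
    let ?n = "N (?P k)" and ?o = "op_norm G (?P k)"
    have n: "0 \<le> ?n" and o: "0 \<le> ?o" by (intro norm_nonneg P op_norm_nonneg bl)+
    have "N (?P (Suc k)) powr q \<le> 2 * D * (?n powr q * ?n powr q * (?o / ?n) powr (q * \<theta>))"
      using diff[OF P P, of k k] by (simp add: algebra_simps)
    also have "?n powr q * ?n powr q * (?o / ?n) powr (q * \<theta>)
        = (?n powr q) powr (2 - \<theta>) * ?o powr (q * \<theta>)"
    \<comment> \<open>If the norm is 0, both sides vanish because
      \<open>0 powr x = 0\<close>.\<close>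
    proof (cases "?n = 0")
      case False
      then show ?thesis
        using n o by (simp add: powr_divide powr_powr powr_diff algebra_simps flip: powr_add)
    qed simp
    also have "?o powr (q * \<theta>) \<le> (r ^ (2 ^ k)) powr (q * \<theta>)"
      using r \<theta> q_pos o by (intro powr_mono2 repeated_square_op_norm_le R) auto
    also have "\<dots> = ((r powr q) ^ (2 ^ k)) powr \<theta>"
      using r by (simp add: powr_powr mult_ac flip: powr_realpow)
    finally show "N (?P (Suc k)) powr q \<le> 2 * D * (?n powr q) powr (2 - \<theta>) * ((r powr q) ^ 2 ^ k) powr \<theta>"
      using D by (simp add: mult_left_mono mult.assoc)
  qed simp
qed

lemma left_inverse_id_minus_contraction:
  assumes R: "R \<in> \<A>" and r: "0 < r" "r < 1"
    "\<And>f. f \<in> ell2 G \<Longrightarrow> ell2_norm G (mat_apply G R f) \<le> r * ell2_norm G f"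
  shows "\<exists>X\<in>\<A>. mat_mult G X (mat_id G - R) = mat_id G"
proof -
  let ?P = "\<lambda>k. ((\<lambda>P. mat_mult G P P) ^^ k) R"
  have P: "?P k \<in> \<A>" for k by (rule repeated_square_closed[OF R])
  obtain K where K: "0 < K" "\<And>A B. A \<in> \<A> \<Longrightarrow> B \<in> \<A> \<Longrightarrow> N (mat_mult G A B) \<le> K * N A * N B"
    using norm_mult by blast
  have "\<forall>\<^sub>F k in sequentially. N (?P k) powr q < (1 / K) powr q"
    using K(1) by (intro order_tendstoD(2)[OF repeated_square_tendsto_0[OF R r]]) auto
  then obtain k where "N (?P k) powr q < (1 / K) powr q"
    by (auto simp: eventually_sequentially)
  then have "N (?P k) < 1 / K"
    using powr_mono2[of q "1 / K" "N (?P k)"] K(1) q_pos by (force simp: not_less[symmetric])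
  then have "K * N (?P k) < 1" using K(1) by (simp add: field_simps)
  then have "\<exists>X\<in>\<A>. mat_mult G X (mat_id G - ?P k) = mat_id G"
    by (intro left_inverse_id_minus[OF P K(1)] K(2))
  then have "\<exists>X\<in>\<A>. mat_mult G X (mat_id G - ?P 0) = mat_id G"
  \<comment> \<open>Descends from \<open>k\<close> to 0: a left inverse for the square of
    \<open>?P k\<close> yields one for \<open>?P k\<close> itself.\<close>
  proof (induction k)
    case (Suc k)
    obtain X where "X \<in> \<A>" "mat_mult G X (mat_id G - mat_mult G (?P k) (?P k)) = mat_id G"
      using Suc.prems by (simp only: funpow.simps o_apply) blast
    then show ?case by (intro Suc.IH left_inverse_id_minus_square[OF P])
  qed simp
  then show ?thesis by simp
qed

theorem inverse_closed:
  assumes T: "T \<in> \<A>" and B: "B \<in> bl_matrices G"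
    and TB: "mat_mult G T B = mat_id G" and BT: "mat_mult G B T = mat_id G"
  shows "B \<in> \<A>"
proof -
  let ?T' = "mat_adj T"
  have T': "?T' \<in> \<A>" by (rule adj_closed[OF T])
  obtain K where K: "1 \<le> K" "\<And>f. f \<in> ell2 G \<Longrightarrow> ell2_norm G (mat_apply G ?T' f) \<le> K * ell2_norm G f"
    using bounded_op_bound_ge_1[OF bl_matricesD(2)[OF bl[OF T']]] by blast
  obtain L where L: "1 \<le> L" "\<And>f. f \<in> ell2 G \<Longrightarrow> ell2_norm G (mat_apply G B f) \<le> L * ell2_norm G f"
    using bounded_op_bound_ge_1[OF bl_matricesD(2)[OF B]] by blast
  have L': "ell2_norm G f \<le> L * ell2_norm G (mat_apply G T f)" if f: "f \<in> ell2 G" for f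
  proof -
    have "mat_apply G B (mat_apply G T f) = f"
      using mat_apply_mult(2)[OF B bl[OF T] f] by (simp add: BT mat_apply_id[OF f])
    then show ?thesis using L(2)[OF bl_matricesD(3)[OF bl[OF T] f]] by simp
  qed
  define \<alpha> where "\<alpha> = complex_of_real (1 / K\<^sup>2)"
  define S where "S = mat_scale \<alpha> ?T'"
  define R where "R = mat_id G - mat_mult G S T"
  have S: "S \<in> \<A>" unfolding S_def by (rule scale_closed[OF T'])
  have ST: "mat_mult G S T \<in> \<A>" by (rule mult_closed[OF S T])
  have R: "R \<in> \<A>" unfolding R_def by (rule diff_closed[OF id_closed ST])
  \<comment> \<open>The maximum with \<open>1 / 2\<close> keeps \<open>r\<close> positive when
    \<open>K = L = 1\<close> makes the root vanish.\<close>
  define r where "r = max (1 / 2) (sqrt (1 - 1 / (K * L)\<^sup>2))"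
  have r: "0 < r" "r < 1" using K(1) L(1) by (auto simp: r_def)
  have R_le: "ell2_norm G (mat_apply G R f) \<le> r * ell2_norm G f" if f: "f \<in> ell2 G" for f
  proof -
    have "mat_apply G R f = mat_apply G (mat_id G) f + mat_apply G (mat_scale (-1) (mat_mult G S T)) f"
      unfolding R_def mat_minus_eq
      by (rule mat_apply_add[OF bl[OF id_closed] bl[OF scale_closed[OF ST]] f])
    also have "\<dots> = f + (\<lambda>i. complex_of_real (- (1 / K\<^sup>2)) * mat_apply G ?T' (mat_apply G T f) i)"
      by (simp add: mat_apply_id[OF f] mat_apply_scale mat_apply_mult(2)[OF bl[OF S] bl[OF T] f])
        (simp add: S_def \<alpha>_def mat_apply_scale)
    finally have "ell2_norm G (mat_apply G R f) \<le> sqrt (1 - 1 / (K * L)\<^sup>2) * ell2_norm G f"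
      using normal_operator_contraction[OF bl[OF T] bl[OF T'] K L(1) L' f] by simp
    also have "\<dots> \<le> r * ell2_norm G f"
      by (rule mult_right_mono[OF _ ell2_norm_nonneg]) (simp add: r_def)
    finally show ?thesis .
  qed
  obtain X where X: "X \<in> \<A>" "mat_mult G X (mat_id G - R) = mat_id G"
    using left_inverse_id_minus_contraction[OF R r R_le] by blast
  have XST: "mat_mult G (mat_mult G X S) T = mat_id G"
    using X(2) by (simp add: R_def mat_mult_assoc bl X S T)
  have XS: "mat_mult G X S \<in> \<A>" by (rule mult_closed[OF X(1) S])
  \<comment> \<open>\<open>mat_mult G X S\<close> is a left inverse of \<open>T\<close> in
    \<open>\<A>\<close>, and \<open>B\<close> is a right inverse; associativity identifies the
    two.\<close>
  have "B = mat_mult G (mat_mult G (mat_mult G X S) T) B"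
    by (simp add: XST mat_mult_id B bl id_closed)
  also have "\<dots> = mat_mult G (mat_mult G X S) (mat_mult G T B)"
    by (rule mat_mult_assoc[OF bl[OF XS] bl[OF T] B])
  also have "\<dots> = mat_mult G X S"
    by (simp add: TB mat_mult_id bl XS id_closed)
  finally show ?thesis using XS by simp
qed

text \<open>An inverse in \<open>\<A>\<close> is also one in \<open>bl_matrices G\<close>;
  conversely \<open>inverse_closed\<close> applies to \<open>z I - A\<close>, which lies in
  \<open>\<A>\<close>.\<close>

theorem spectral_set_eq:
  assumes A: "A \<in> \<A>"
  shows "spectral_set G \<A> A = spectral_set G (bl_matrices G) A"
proof -
  have "mat_scale z (mat_id G) - A \<in> \<A>" for z
    by (rule diff_closed[OF scale_closed[OF id_closed] A])
  then have "resolvent_set G \<A> A = resolvent_set G (bl_matrices G) A"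
    unfolding resolvent_set_def using bl inverse_closed by blast
  then show ?thesis by (simp add: spectral_set_def)
qed

end

theorem theorem6p3:
  fixes G :: "(int ^ 'd) set" and q :: real
    and \<A> :: "(int ^ 'd) cmatrix set" and N :: "(int ^ 'd) cmatrix \<Rightarrow> real"
  assumes "0 < q" and "q \<le> 1"
    and "proper_q_banach_algebra G q \<A> N"
  shows "\<forall>A\<in>\<A>. spectral_set G \<A> A = spectral_set G (bl_matrices G) A"
  using proper_q_banach_algebra.spectral_set_eq[OF assms(3)] by blast

end
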